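(* Let $f:\mathbb{R}^m\to\mathbb{R}^{2m-1}$ be a smooth map, and let $\mu:\mathbb{R}^m\to\mathbb{R}^s$, $s=\binom{2m-1}{m}$, be the map whose components $\mu(x)$ are all the $m\times m$ minors of the Jacobian matrix $Df(x)$. A point $p\in\mathbb{R}^m$ is a cross-cap singularity of $f$ if and only if $\operatorname{rank}Df(p)=m-1$ and $\operatorname{rank}D\mu(p)=m$.
   Context: Let $J^1(\mathbb{R}^m,\mathbb{R}^{2m-1})\cong\mathbb{R}^m\times\mathbb{R}^{2m-1}\times M(2m-1,m)$ be the space of 1-jets, where $M(2m-1,m)$ is the space of real $(2m-1)\times m$ matrices, and let $j^1f:\mathbb{R}^m\to J^1(\mathbb{R}^m,\mathbb{R}^{2m-1})$, $j^1f(x)=(x,f(x),Df(x))$. Let $S_1=\{\sigma\in J^1(\mathbb{R}^m,\mathbb{R}^{2m-1}):\operatorname{corank}\sigma=1\}$ (jets whose matrix has rank $m-1$), a submanifold of codimension $m$, and $S_1(f)=(j^1f)^{-1}(S_1)$. A point $p\in S_1(f)$ is a cross-cap singularity of $f$ if $j^1f$ is transversal to $S_1$ at $p$. *)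

theory Defs
  imports "HOL-Analysis.Analysis"
begin

text \<open>Continuous differentiability of order k, by recursion through the directional derivatives.
  Meant for open S: the derivatives are taken at x, not within S.\<close>

primrec Ck_on :: "nat \<Rightarrow> ('a::euclidean_space \<Rightarrow> 'b::euclidean_space) \<Rightarrow> 'a set \<Rightarrow> bool" where
  "Ck_on 0 f S \<longleftrightarrow> continuous_on S f"
| "Ck_on (Suc k) f S \<longleftrightarrow>
     (\<forall>x\<in>S. f differentiable (at x)) \<and> (\<forall>v. Ck_on k (\<lambda>x. frechet_derivative f (at x) v) S)"

definition smooth_on :: "'a::euclidean_space set \<Rightarrow> ('a \<Rightarrow> 'b::euclidean_space) \<Rightarrow> bool" where
  "smooth_on S f \<longleftrightarrow> (\<forall>k. Ck_on k f S)"

text \<open>The tangent space at q of a submanifold W of a Euclidean space, as the set of velocities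
  of smooth curves in W through q.\<close>

definition tangent_space :: "'a::euclidean_space set \<Rightarrow> 'a \<Rightarrow> 'a set" where
  "tangent_space W q =
     {v. \<exists>\<gamma> :: real \<Rightarrow> 'a. \<exists>\<epsilon>>0. smooth_on {-\<epsilon><..<\<epsilon>} \<gamma> \<and> \<gamma> ` {-\<epsilon><..<\<epsilon>} \<subseteq> W \<and>
           \<gamma> 0 = q \<and> (\<gamma> has_vector_derivative v) (at 0)}"

definition transversal_at ::
    "('a::euclidean_space \<Rightarrow> 'b::euclidean_space) \<Rightarrow> 'b set \<Rightarrow> 'a \<Rightarrow> bool" where
  "transversal_at F W p \<longleftrightarrow> F p \<notin> W \<or>
     {u + v | u v. u \<in> range (frechet_derivative F (at p)) \<and> v \<in> tangent_space W (F p)} = UNIV"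

type_synonym ('m, 'n) jet1 = "(real^'m) \<times> (real^'n) \<times> (real^'m^'n)"

definition j1 :: "(real^'m \<Rightarrow> real^'n) \<Rightarrow> real^'m \<Rightarrow> ('m::finite, 'n::finite) jet1" where
  "j1 f x = (x, f x, jacobian f (at x))"

definition corank :: "('m::finite, 'n::finite) jet1 \<Rightarrow> nat" where
  "corank \<sigma> = min CARD('m) CARD('n) - rank (snd (snd \<sigma>))"

definition S1 :: "('m::finite, 'n::finite) jet1 set" where
  "S1 = {\<sigma>. corank \<sigma> = 1}"

definition S1_of :: "(real^'m \<Rightarrow> real^'n) \<Rightarrow> (real^('m::finite)) set" where
  "S1_of f = j1 f -` (S1 :: ('m, 'n::finite) jet1 set)"

definition cross_cap :: "(real^'m::finite \<Rightarrow> real^'n::finite) \<Rightarrow> real^'m \<Rightarrow> bool" where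
  "cross_cap f p \<longleftrightarrow> p \<in> S1_of f \<and> transversal_at (j1 f) S1 p"

text \<open>The maximal minors of an n by m matrix correspond to the m-element sets of rows.  An
  enumeration r of them by the index type 's lists every such set exactly once, as the range of
  the injection r s; this injection fixes the order of the rows, hence the sign of the minor.
  Since index types carry no order, all choices of r are allowed.\<close>

definition minor_enumeration :: "('s \<Rightarrow> 'm::finite \<Rightarrow> 'n::finite) \<Rightarrow> bool" where
  "minor_enumeration r \<longleftrightarrow>
     (\<forall>s. inj (r s)) \<and> bij_betw (\<lambda>s. range (r s)) UNIV {I. card I = CARD('m)}"

definition minors_map :: "('s::finite \<Rightarrow> 'm::finite \<Rightarrow> 'n::finite) \<Rightarrow>
    (real^'m \<Rightarrow> real^'n) \<Rightarrow> real^'m \<Rightarrow> real^'s" where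
  "minors_map r f x = (\<chi> s. det (\<chi> i j. jacobian f (at x) $ r s i $ j))"

end

(* Let A = Df(p) have rank m - 1, let k span its kernel, and let L v be the derivative of Df at p
   in direction v, applied to k.  Differentiating a curve A(t) through A, the derivatives of all
   maximal minors vanish iff A'(0) k lies in the range of A.  This gives two facts at once: the
   tangent space of S_1 consists of the (a, b, B) with B k in range A, and the kernel of Dmu(p) is
   the set of v with L v in range A.  Hence transversality means range L + range A = R^(2m-1);
   as dim range A = m - 1, this holds iff L v in range A forces v = 0, i.e. iff Dmu(p) is
   injective. *)
theory Submission
  imports Defs
begin

lemma tendsto_det:
  fixes A :: "'a \<Rightarrow> real^'n^'n"
  assumes "(A \<longlongrightarrow> B) F"
  shows "((\<lambda>x. det (A x)) \<longlongrightarrow> det B) F"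
  unfolding det_def by (intro tendsto_intros assms)

lemma differentiable_det:
  fixes A :: "'a::real_normed_vector \<Rightarrow> real^'n^'n"
  assumes "\<And>i j. (\<lambda>x. A x $ i $ j) differentiable (at x)"
  shows "(\<lambda>x. det (A x)) differentiable (at x)"
proof -
  have "(\<lambda>x. \<Prod>i\<in>UNIV. A x $ i $ p i) differentiable (at x)" for p
  proof -
    have "\<exists>D. \<forall>i. ((\<lambda>x. A x $ i $ p i) has_derivative D i) (at x)"
      by (rule choice) (use assms in \<open>simp add: differentiable_def\<close>)
    then obtain D where "\<And>i. ((\<lambda>x. A x $ i $ p i) has_derivative D i) (at x)"
      by blast
    then show ?thesis
      unfolding differentiable_def
      using has_derivative_prod[of UNIV "\<lambda>i x. A x $ i $ p i" D x UNIV] by blast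
  qed
  then show ?thesis
    unfolding det_def by (intro differentiable_sum differentiable_mult differentiable_const) auto
qed

lemma has_real_derivative_det:
  fixes A :: "real \<Rightarrow> real^'m^'m"
  assumes A: "(A has_vector_derivative B) (at 0)" and k: "A 0 *v k = 0" "k $ j0 \<noteq> 0"
  shows "((\<lambda>t. det (A t)) has_real_derivative
    det (\<chi> i j. if j = j0 then (B *v k) $ i else A 0 $ i $ j) / k $ j0) (at 0)"
proof -
  \<comment> \<open>By Cramer's rule, k $ j0 * det (A t) is the determinant of A t with column j0
    replaced by A t *v k, a column that vanishes at t = 0.\<close>
  let ?C = "\<lambda>v t. (\<chi> i j. if j = j0 then v $ i else A t $ i $ j) :: real^'m^'m"
  have det_eq: "det (A t) = det (?C (A t *v k) t) / k $ j0" for t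
    using cramer_lemma[of j0 "A t" k] k by (simp add: field_simps)
  have scale: "det (?C (c *\<^sub>R v) t) = c * det (?C v t)" for c v t
  proof -
    have *: "transpose (?C v t) = (\<chi> i. if i = j0 then v else column i (A t))" for v
      by (simp add: vec_eq_iff transpose_def column_def)
    have "det (transpose (?C (c *s v) t)) = c * det (transpose (?C v t))"
      unfolding * by (rule det_row_mul)
    then show ?thesis
      unfolding det_transpose scalar_mult_eq_scaleR .
  qed
  have "det (A 0) = 0"
    unfolding det_eq k(1) using scale[of 0 0 0]
    by (simp only: scaleR_zero_left mult_zero_left div_0)
  \<comment> \<open>Since \<open>A 0 *v k = 0\<close>, the vector \<open>A t *v k\<close> divided by
    \<open>t\<close> is already a difference quotient.\<close>
  have lim_Ak: "((\<lambda>t. (1/t) *\<^sub>R (A t *v k)) \<longlongrightarrow> B *v k) (at 0)"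
  proof -
    have "((\<lambda>t. A t *v k) has_vector_derivative B *v k) (at 0)"
      by (rule bounded_linear.has_vector_derivative[OF _ A])
        (intro linear_conv_bounded_linear[THEN iffD1] linearI;
          simp add: matrix_vector_mult_add_rdistrib scaleR_matrix_vector_assoc)
    then have "((\<lambda>t. (A t *v k) $ i) has_real_derivative (B *v k) $ i) (at 0)" for i
      unfolding has_real_derivative_iff_has_vector_derivative
      by (rule bounded_linear.has_vector_derivative[OF bounded_linear_vec_nth])
    then have "((\<lambda>t. ((1/t) *\<^sub>R (A t *v k)) $ i) \<longlongrightarrow> (B *v k) $ i) (at 0)" for i
      by (simp add: DERIV_def k)
    then show ?thesis
      by (rule vec_tendstoI)
  qed
  have "(A \<longlongrightarrow> A 0) (at 0)"
    using has_vector_derivative_continuous[OF A] by (simp add: continuous_at)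
  then have "((\<lambda>t. if j = j0 then ((1/t) *\<^sub>R (A t *v k)) $ i else A t $ i $ j)
      \<longlongrightarrow> (if j = j0 then (B *v k) $ i else A 0 $ i $ j)) (at 0)" for i j
    using tendsto_vec_nth[OF lim_Ak, of i] tendsto_vec_nth[OF tendsto_vec_nth, of A "A 0" "at 0" i j]
    by (cases "j = j0") simp_all
  then have "((\<lambda>t. ?C ((1/t) *\<^sub>R (A t *v k)) t) \<longlongrightarrow> ?C (B *v k) 0) (at 0)"
    by (intro tendsto_vec_lambda)
  from tendsto_divide[OF tendsto_det[OF this] tendsto_const k(2)]
  have "((\<lambda>t. det (?C ((1/t) *\<^sub>R (A t *v k)) t) / k $ j0)
      \<longlongrightarrow> det (?C (B *v k) 0) / k $ j0) (at 0)" .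
  \<comment> \<open>Dividing one column by \<open>t\<close> divides the determinant by
    \<open>t\<close>. At \<open>t = 0\<close> both sides are 0, because division by zero gives
    0.\<close>
  moreover have "det (?C ((1/t) *\<^sub>R (A t *v k)) t) / k $ j0 = (det (A (0 + t)) - det (A 0)) / t" for t
    unfolding scale \<open>det (A 0) = 0\<close> using det_eq[of t] by simp
  ultimately show ?thesis
    unfolding DERIV_def by (simp only:)
qed

section \<open>Rank, kernels and maximal minors\<close>

lemma rank_less_iff_kernel:
  fixes A :: "real^'m^'n"
  shows "rank A < CARD('m) \<longleftrightarrow> (\<exists>x. x \<noteq> 0 \<and> A *v x = 0)"
  using matrix_nonfull_linear_equations_eq[of A] rank_bound[of A] by auto

text \<open>A kernel vector of \<open>M\<close> is also one of every square submatrix formed from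
  its rows. Conversely, at full rank some \<open>CARD('m)\<close> rows form a basis, and the
  enumeration lists their index set.\<close>

lemma minors_vanish_iff:
  fixes M :: "real^'m::finite^'n::finite" and r :: "'s::finite \<Rightarrow> 'm \<Rightarrow> 'n"
  assumes r: "minor_enumeration r"
  shows "(\<forall>s. det (\<chi> i j. M $ r s i $ j) = 0) \<longleftrightarrow> rank M < CARD('m)"
proof
  assume "rank M < CARD('m)"
  then obtain y where y: "y \<noteq> 0" "M *v y = 0"
    using rank_less_iff_kernel by metis
  show "\<forall>s. det (\<chi> i j. M $ r s i $ j) = 0"
  proof
    fix s
    have "(\<chi> i j. M $ r s i $ j) *v y = 0"
      using y(2) by (simp add: vec_eq_iff matrix_vector_mult_def)
    with y(1) show "det (\<chi> i j. M $ r s i $ j) = 0"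
      unfolding det_eq_0_rank rank_less_iff_kernel by blast
  qed
next
  assume minors: "\<forall>s. det (\<chi> i j. M $ r s i $ j) = 0"
  show "rank M < CARD('m)"
  proof (rule ccontr)
    assume "\<not> rank M < CARD('m)"
    then have rank: "rank M = CARD('m)"
      using rank_bound[of M] by simp
    obtain B where B: "B \<subseteq> rows M" "independent B" "card B = CARD('m)"
      using basis_exists[of "rows M"] rank by (metis row_rank_def)
    have "\<forall>b\<in>B. \<exists>i. b = row i M"
      using B(1) by (auto simp: rows_def)
    then obtain h where h: "\<And>b. b \<in> B \<Longrightarrow> row (h b) M = b"
      by metis
    \<comment> \<open>\<open>h\<close> picks a row index for each basis vector; \<open>row\<close>
      undoes this choice, so exactly \<open>CARD('m)\<close> indices are picked.\<close>
    have "inj_on h B"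
      using h by (metis inj_onI)
    then have "h ` B \<in> {I. card I = CARD('m)}"
      using B(3) by (simp add: card_image)
    also have "\<dots> = range (\<lambda>s. range (r s))"
      using r by (simp add: minor_enumeration_def bij_betw_def)
    finally obtain s where s: "range (r s) = h ` B"
      by auto
    have "rows (\<chi> i j. M $ r s i $ j) = (\<lambda>i. row i M) ` range (r s)"
      by (auto simp: rows_def row_def)
    also have "\<dots> = B"
      using h by (force simp: s)
    finally have "rank (\<chi> i j. M $ r s i $ j) = CARD('m)"
      using B by (simp add: row_rank_def dim_eq_card_independent)
    then show False
      using minors unfolding det_eq_0_rank by (metis less_irrefl)
  qed
qed

text \<open>The kernel is the orthogonal complement of the row space, so its dimension is 1.\<close>

lemma kernel_corank_one:
  fixes A :: "real^'m::finite^'n::finite"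
  assumes "rank A = CARD('m) - 1"
  obtains k where "k \<noteq> 0" "A *v k = 0" "\<And>x. A *v x = 0 \<Longrightarrow> \<exists>c. x = c *\<^sub>R k"
proof -
  let ?N = "{x. A *v x = 0}"
  have "(\<forall>x\<in>span (rows A). orthogonal x y) \<longleftrightarrow> A *v y = 0" for y
  proof
    assume "\<forall>x\<in>span (rows A). orthogonal x y"
    then have "\<forall>i. row i A \<bullet> y = 0"
      by (auto simp: orthogonal_def rows_def intro: span_base)
    then show "A *v y = 0"
      by (simp add: vec_eq_iff matrix_vector_mul_component row_def)
  qed (use orthogonal_nullspace_rowspace orthogonal_commute in blast)
  then have "dim ?N + dim (rows A) = CARD('m)"
    using dim_subspace_orthogonal_to_vectors[of "span (rows A)" UNIV] by (simp add: subspace_span)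
  then have "dim ?N = 1"
    using assms zero_less_card_finite[where 'a='m] unfolding row_rank_def by linarith
  then obtain B where B: "B \<subseteq> ?N" "independent B" "?N \<subseteq> span B" "card B = 1"
    using basis_exists by metis
  then obtain k where k: "B = {k}"
    by (auto simp: card_1_singleton_iff)
  show ?thesis
  proof
    show "k \<noteq> 0" using B(2) k dependent_zero by blast
    show "A *v k = 0" using B(1) k by blast
    show "\<exists>c. x = c *\<^sub>R k" if "A *v x = 0" for x
      using that B(3) k by (auto simp: span_singleton)
  qed
qed

text \<open>Because \<open>k $ j0\<close> is nonzero, column \<open>j0\<close> of \<open>A\<close>
  is a combination of the other columns; because \<open>k\<close> spans the kernel, those others are
  independent. They therefore form a basis of the range of \<open>A\<close>, and putting
  \<open>b\<close> beside them lowers the rank exactly when \<open>b\<close> lies in that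
  range.\<close>

lemma rank_column_replaced:
  fixes A :: "real^'m::finite^'n::finite"
  assumes k: "A *v k = 0" "k $ j0 \<noteq> 0" and ker: "\<And>x. A *v x = 0 \<Longrightarrow> \<exists>c. x = c *\<^sub>R k"
  shows "rank (\<chi> i j. if j = j0 then b $ i else A $ i $ j) < CARD('m) \<longleftrightarrow> b \<in> range ((*v) A)"
    (is "rank ?M < _ \<longleftrightarrow> _")
proof -
  \<comment> \<open>The contribution of column \<open>j0\<close> is split off; \<open>A\<close> then
    acts on \<open>y\<close> with entry \<open>j0\<close> set to zero.\<close>
  have M: "?M *v y = y $ j0 *\<^sub>R b + A *v (y - axis j0 (y $ j0))" for y
  proof -
    have "(\<Sum>j\<in>UNIV. (if j = j0 then b $ i else A $ i $ j) * y $ j)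
        = (\<Sum>j\<in>UNIV. (if j = j0 then y $ j0 * b $ i else 0)
            + A $ i $ j * (y $ j - axis j0 (y $ j0) $ j))" for i
      by (rule sum.cong) (auto simp: axis_def)
    then have "(\<Sum>j\<in>UNIV. (if j = j0 then b $ i else A $ i $ j) * y $ j)
        = y $ j0 * b $ i + (\<Sum>j\<in>UNIV. A $ i $ j * (y $ j - axis j0 (y $ j0) $ j))" for i
      by (simp only: sum.distrib sum.delta finite_UNIV if_True finite UNIV_I)
    then show ?thesis
      by (simp add: vec_eq_iff matrix_vector_mult_def)
  qed
  have "rank ?M < CARD('m) \<longleftrightarrow> (\<exists>y. y \<noteq> 0 \<and> ?M *v y = 0)"
    by (rule rank_less_iff_kernel)
  also have "\<dots> \<longleftrightarrow> b \<in> range ((*v) A)"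
  proof
    assume "\<exists>y. y \<noteq> 0 \<and> ?M *v y = 0"
    then obtain y where y: "y \<noteq> 0" "y $ j0 *\<^sub>R b + A *v (y - axis j0 (y $ j0)) = 0"
      unfolding M by blast
    \<comment> \<open>Otherwise \<open>y\<close> is in the kernel of \<open>A\<close>, hence a
      multiple of \<open>k\<close> with entry \<open>j0\<close> zero, which forces
      \<open>y = 0\<close>.\<close>
    have "y $ j0 \<noteq> 0"
    proof
      assume 0: "y $ j0 = 0"
      have "axis j0 0 = (0 :: real^'m)"
        by (simp add: vec_eq_iff axis_def)
      with y(2) have "A *v y = 0"
        unfolding 0 by (metis add_0 diff_zero scale_zero_left)
      then obtain c where "y = c *\<^sub>R k"
        using ker by blast
      with 0 k(2) y(1) show False by simp
    qed
    with y(2) have "b = A *v ((- 1 / y $ j0) *\<^sub>R (y - axis j0 (y $ j0)))"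
      unfolding matrix_vector_mult_scaleR add_eq_0_iff
      by simp
    then show "b \<in> range ((*v) A)" by blast
  next
    assume "b \<in> range ((*v) A)"
    then obtain z where z: "b = A *v z" by blast
    \<comment> \<open>The multiple of \<open>k\<close> does not affect \<open>A *v y\<close> and is
      chosen to make entry \<open>j0\<close> of \<open>y\<close> equal to 1.\<close>
    define y where "y = axis j0 1 - z + (z $ j0 / k $ j0) *\<^sub>R k"
    have "y $ j0 = 1"
      using k(2) by (simp add: y_def)
    moreover have "A *v (y - axis j0 1) = - b"
      using k(1) by (simp add: y_def z matrix_vector_mult_diff_distrib matrix_vector_right_distrib
          matrix_vector_mult_scaleR)
    ultimately have "?M *v y = 0" "y \<noteq> 0"
      unfolding M by auto
    then show "\<exists>y. y \<noteq> 0 \<and> ?M *v y = 0" by blast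
  qed
  finally show ?thesis .
qed

text \<open>Up to the common factor \<open>1 / k $ j0\<close>, the numbers \<open>d s\<close> are
  the maximal minors of a single matrix: \<open>A 0\<close> with column \<open>j0\<close> replaced
  by \<open>B *v k\<close>. This works because selecting rows commutes with replacing a column and
  with multiplication by \<open>k\<close>.\<close>

lemma minors_derivative_vanish_iff:
  fixes A :: "real \<Rightarrow> real^'m::finite^'n::finite" and r :: "'s::finite \<Rightarrow> 'm \<Rightarrow> 'n"
  assumes r: "minor_enumeration r" and A: "(A has_vector_derivative B) (at 0)"
    and k: "k \<noteq> 0" "A 0 *v k = 0" and ker: "\<And>x. A 0 *v x = 0 \<Longrightarrow> \<exists>c. x = c *\<^sub>R k"
    and d: "\<And>s. ((\<lambda>t. det (\<chi> i j. A t $ r s i $ j)) has_real_derivative d s) (at 0)"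
  shows "(\<forall>s. d s = 0) \<longleftrightarrow> B *v k \<in> range ((*v) (A 0))"
proof -
  obtain j0 where j0: "k $ j0 \<noteq> 0"
    using k(1) by (auto simp: vec_eq_iff)
  let ?M = "(\<chi> i j. if j = j0 then (B *v k) $ i else A 0 $ i $ j) :: real^'m^'n"
  have "d s = det (\<chi> i j. ?M $ r s i $ j) / k $ j0" for s
  proof -
    let ?sub = "\<lambda>C. (\<chi> i j. C $ r s i $ j) :: real^'m^'m"
    have "((\<lambda>t. ?sub (A t)) has_vector_derivative ?sub B) (at 0)"
      by (rule bounded_linear.has_vector_derivative[OF _ A])
        (intro linear_conv_bounded_linear[THEN iffD1] linearI; simp add: vec_eq_iff)
    moreover have sub: "?sub C *v x = (\<chi> i. (C *v x) $ r s i)" for C x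
      by (simp add: vec_eq_iff matrix_vector_mult_def)
    then have "?sub (A 0) *v k = 0"
      using k(2) by (simp add: vec_eq_iff)
    ultimately have "((\<lambda>t. det (?sub (A t))) has_real_derivative
        det (\<chi> i j. if j = j0 then (?sub B *v k) $ i else ?sub (A 0) $ i $ j) / k $ j0) (at 0)"
      using j0 by (rule has_real_derivative_det)
    from DERIV_unique[OF d this] show ?thesis
      unfolding sub by (simp cong: if_cong)
  qed
  then have "(\<forall>s. d s = 0) \<longleftrightarrow> (\<forall>s. det (\<chi> i j. ?M $ r s i $ j) = 0)"
    using j0 by simp
  also have "\<dots> \<longleftrightarrow> B *v k \<in> range ((*v) (A 0))"
    unfolding minors_vanish_iff[OF r] by (rule rank_column_replaced[OF k(2) j0 ker])
  finally show ?thesis .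
qed

text \<open>A dimension count: the sum has dimension \<open>rank M + dim T\<close> minus that of the
  intersection, which reaches \<open>CARD('n)\<close> only if \<open>M\<close> is injective and its
  range meets \<open>T\<close> trivially.\<close>

lemma range_plus_subspace_eq_UNIV_iff:
  fixes M :: "real^'m::finite^'n::finite"
  assumes T: "subspace T" and dim: "CARD('m) + dim T = CARD('n)"
  shows "{M *v v + y | v y. y \<in> T} = UNIV \<longleftrightarrow> (\<forall>v. M *v v \<in> T \<longrightarrow> v = 0)"
proof -
  let ?R = "range ((*v) M)"
  have R: "subspace ?R"
    by (simp add: linear_subspace_image)
  have sum_eq: "{M *v v + y | v y. y \<in> T} = {x + y | x y. x \<in> ?R \<and> y \<in> T}"
    by blast
  have span: "span {x + y | x y. x \<in> ?R \<and> y \<in> T} = {x + y | x y. x \<in> ?R \<and> y \<in> T}"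
    by (simp only: span_eq_iff subspace_sums[OF R T])
  have "{M *v v + y | v y. y \<in> T} = UNIV \<longleftrightarrow> dim {M *v v + y | v y. y \<in> T} = CARD('n)"
    unfolding sum_eq using dim_eq_full[of "{x + y | x y. x \<in> ?R \<and> y \<in> T}", unfolded span]
    by (simp only: DIM_cart DIM_real mult_1_right)
  also have "\<dots> \<longleftrightarrow> rank M = CARD('m) \<and> dim (?R \<inter> T) = 0"
    using dim_sums_Int[OF R T] dim rank_bound[of M] unfolding sum_eq rank_dim_range by linarith
  also have "\<dots> \<longleftrightarrow> (\<forall>v. M *v v = 0 \<longrightarrow> v = 0) \<and> ?R \<inter> T \<subseteq> {0}"
    using rank_less_iff_kernel[of M] rank_bound[of M] by (auto simp: dim_eq_0)
  also have "\<dots> \<longleftrightarrow> (\<forall>v. M *v v \<in> T \<longrightarrow> v = 0)"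
    using subspace_0[OF T] by auto
  finally show ?thesis .
qed

section \<open>The tangent space of \<open>S1\<close>\<close>

lemma Ck_on_quadratic_curve:
  fixes a b c :: "'a::euclidean_space"
  shows "Ck_on k (\<lambda>t::real. a + t *\<^sub>R b + t\<^sup>2 *\<^sub>R c) S"
proof (induction k arbitrary: a b c)
  case 0
  show ?case by (auto intro!: continuous_intros)
next
  case (Suc k)
  have D: "((\<lambda>t::real. a + t *\<^sub>R b + t\<^sup>2 *\<^sub>R c) has_derivative (\<lambda>v. v *\<^sub>R b + (2 * t * v) *\<^sub>R c)) (at t)" for t
    by (auto intro!: derivative_eq_intros simp: algebra_simps)
  \<comment> \<open>The derivative is written as a quadratic curve with new coefficients, the last
    one zero, so that the induction hypothesis applies.\<close>
  have "(\<lambda>t. frechet_derivative (\<lambda>t::real. a + t *\<^sub>R b + t\<^sup>2 *\<^sub>R c) (at t) v)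
      = (\<lambda>t. v *\<^sub>R b + t *\<^sub>R ((2 * v) *\<^sub>R c) + t\<^sup>2 *\<^sub>R 0)" for v
    by (simp only: frechet_derivative_at[OF D, symmetric]) (simp add: algebra_simps)
  with Suc show ?case
    using D by (simp only: Ck_on.simps) (blast intro: differentiableI)
qed

lemma eventually_invertible:
  fixes X :: "real^'n::finite^'n"
  shows "\<forall>\<^sub>F t in nhds (0::real). invertible (mat 1 + t *\<^sub>R X)"
proof -
  have "((\<lambda>t. det (mat 1 + t *\<^sub>R X)) \<longlongrightarrow> det (mat 1 + 0 *\<^sub>R X)) (nhds (0::real))"
    by (intro tendsto_det tendsto_intros filterlim_ident)
  then have "\<forall>\<^sub>F t in nhds (0::real). det (mat 1 + t *\<^sub>R X) \<noteq> 0"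
    by (rule tendsto_imp_eventually_ne) simp
  then show ?thesis
    by (simp add: invertible_det_nz)
qed

lemma rank_mult_invertible:
  fixes A :: "real^'m::finite^'n::finite"
  assumes "invertible P" "invertible Q"
  shows "rank (P ** A ** Q) = rank A"
proof (rule antisym)
  show "rank (P ** A ** Q) \<le> rank A"
    using rank_mul_le_left rank_mul_le_right order_trans by blast
  obtain P' Q' where "P' ** P = mat 1" "Q ** Q' = mat 1"
    using assms by (auto simp: invertible_def)
  then have "A = P' ** (P ** A ** Q) ** Q'"
    by (metis matrix_mul_assoc matrix_mul_lid matrix_mul_rid)
  then show "rank A \<le> rank (P ** A ** Q)"
    using rank_mul_le_left rank_mul_le_right order_trans by metis
qed

text \<open>Take \<open>X\<close> to be \<open>C\<close> composed with a linear right inverse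
  \<open>g\<close> of \<open>A\<close> on its range: \<open>g (A *v x) - x\<close> lies in the
  kernel of \<open>A\<close>, so \<open>C\<close> kills it.\<close>

lemma matrix_factor_through:
  fixes A C :: "real^'m::finite^'n::finite"
  assumes "\<And>x. A *v x = 0 \<Longrightarrow> C *v x = 0"
  obtains X where "X ** A = C"
proof -
  obtain g where g: "linear g" "\<And>x. A *v g (A *v x) = A *v x"
    using linear_exists_right_inverse_on[of "(*v) A" UNIV] by (auto simp: image_iff)
  have "C *v g (A *v x) = C *v x" for x
    using assms[of "g (A *v x) - x"] g(2) by (simp add: matrix_vector_mult_diff_distrib)
  then have "(C ** matrix g ** A) *v x = C *v x" for x
    using g(1) by (simp add: matrix_works flip: matrix_vector_mul_assoc)
  then show ?thesis
    using that by (metis matrix_eq)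
qed

lemma matrix_add_rdistrib: "(A + B) ** C = A ** C + B ** C"
  by (vector matrix_matrix_mult_def sum.distrib[symmetric] field_simps)

lemma mem_S1_iff:
  assumes "CARD('m) \<le> CARD('n)"
  shows "\<sigma> \<in> (S1 :: ('m::finite, 'n::finite) jet1 set) \<longleftrightarrow> rank (snd (snd \<sigma>)) = CARD('m) - 1"
proof -
  \<comment> \<open>Positivity is needed because natural-number subtraction truncates.\<close>
  have "0 < CARD('m)" by simp
  then have "CARD('m) - rank (snd (snd \<sigma>)) = 1 \<longleftrightarrow> rank (snd (snd \<sigma>)) = CARD('m) - 1"
    by linarith
  then show ?thesis
    using assms by (simp add: S1_def corank_def min_def)
qed

lemma matrix_with_prescribed_value:
  fixes k :: "real^'m::finite" and x :: "real^'n::finite"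
  assumes "k \<noteq> 0"
  obtains C :: "real^'m^'n" where "C *v k = x"
proof
  \<comment> \<open>The witness is the outer product of \<open>x\<close> and \<open>k\<close>,
    normalised by \<open>k \<bullet> k\<close>.\<close>
  have "((\<chi> i j. x $ i * k $ j / (k \<bullet> k)) *v k) $ i = x $ i * (k \<bullet> k) / (k \<bullet> k)" for i
    unfolding matrix_vector_mult_def inner_vec_def sum_distrib_left sum_divide_distrib
    by (simp add: mult.assoc)
  then show "(\<chi> i j. x $ i * k $ j / (k \<bullet> k)) *v k = x"
    using assms unfolding vec_eq_iff by (metis inner_eq_zero_iff nonzero_mult_div_cancel_right)
qed

text \<open>Along a curve in \<open>S1\<close> all maximal minors vanish, hence so do their
  derivatives, which gives one inclusion. For the other, \<open>B\<close> is written as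
  \<open>X ** A + A ** Y\<close>, the velocity of a curve that multiplies \<open>A\<close> by
  invertible matrices on both sides.\<close>

lemma tangent_space_S1:
  fixes \<sigma> :: "('m::finite, 'n::finite) jet1" and r :: "'s::finite \<Rightarrow> 'm \<Rightarrow> 'n"
  assumes r: "minor_enumeration r" and le: "CARD('m) \<le> CARD('n)" and \<sigma>: "\<sigma> \<in> S1"
    and k: "k \<noteq> 0" "snd (snd \<sigma>) *v k = 0"
    and ker: "\<And>x. snd (snd \<sigma>) *v x = 0 \<Longrightarrow> \<exists>c. x = c *\<^sub>R k"
  shows "tangent_space S1 \<sigma> = {(a, b, B). B *v k \<in> range ((*v) (snd (snd \<sigma>)))}"
proof (intro set_eqI iffI)
  fix w
  assume "w \<in> tangent_space S1 \<sigma>"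
  then obtain \<gamma> \<epsilon> where \<epsilon>: "\<epsilon> > 0" and S1: "\<gamma> ` {-\<epsilon><..<\<epsilon>} \<subseteq> S1"
    and \<gamma>: "\<gamma> 0 = \<sigma>" "(\<gamma> has_vector_derivative w) (at 0)"
    by (auto simp: tangent_space_def)
  let ?A = "\<lambda>t. snd (snd (\<gamma> t))"
  have A: "(?A has_vector_derivative snd (snd w)) (at 0)"
    by (intro bounded_linear.has_vector_derivative[OF bounded_linear_snd] \<gamma>(2))
  have near: "\<forall>\<^sub>F t in nhds 0. t \<in> {-\<epsilon><..<\<epsilon>}"
    using \<epsilon> by (intro eventually_nhds_in_open) auto
  have "((\<lambda>t. det (\<chi> i j. ?A t $ r s i $ j)) has_real_derivative 0) (at 0)" for s
  proof -
    have "det (\<chi> i j. ?A t $ r s i $ j) = 0" if "t \<in> {-\<epsilon><..<\<epsilon>}" for t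
    proof -
      have "rank (?A t) < CARD('m)"
        using S1 that mem_S1_iff[OF le, of "\<gamma> t"] zero_less_card_finite[where 'a='m]
        by (metis diff_less image_subset_iff zero_less_one)
      then show ?thesis
        using minors_vanish_iff[OF r] by blast
    qed
    then have "\<forall>\<^sub>F t in nhds 0. det (\<chi> i j. ?A t $ r s i $ j) = 0"
      using near by (auto elim: eventually_mono)
    then show ?thesis
      by (subst DERIV_cong_ev[OF refl _ refl, of _ "\<lambda>_. 0"]) auto
  qed
  from minors_derivative_vanish_iff[OF r A, of k "\<lambda>_. 0"] this k ker
  show "w \<in> {(a, b, B). B *v k \<in> range ((*v) (snd (snd \<sigma>)))}"
    by (auto simp: \<gamma>(1) case_prod_beta)
next
  fix w :: "('m, 'n) jet1"
  assume "w \<in> {(a, b, B). B *v k \<in> range ((*v) (snd (snd \<sigma>)))}"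
  then obtain a b B z where w: "w = (a, b, B)" and z: "B *v k = snd (snd \<sigma>) *v z"
    by auto
  obtain q q' A where \<sigma>_eq: "\<sigma> = (q, q', A)"
    by (cases \<sigma>)
  \<comment> \<open>With this \<open>Y\<close>, the matrix \<open>B - A ** Y\<close> kills
    \<open>k\<close> and hence the whole kernel of \<open>A\<close>, so it factors as
    \<open>X ** A\<close>.\<close>
  obtain Y where "Y *v k = z"
    using matrix_with_prescribed_value[OF k(1)] by blast
  then have "(B - A ** Y) *v k = 0"
    unfolding matrix_vector_mult_diff_rdistrib matrix_vector_mul_assoc[symmetric] z
    by (simp add: \<sigma>_eq)
  then have "(B - A ** Y) *v x = 0" if "A *v x = 0" for x
    using ker[of x] that by (auto simp: \<sigma>_eq matrix_vector_mult_scaleR)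
  then obtain X where X: "X ** A = B - A ** Y"
    using matrix_factor_through by blast
  have "\<forall>\<^sub>F t in nhds (0::real). invertible (mat 1 + t *\<^sub>R X) \<and> invertible (mat 1 + t *\<^sub>R Y)"
    by (intro eventually_conj eventually_invertible)
  then obtain \<epsilon> where \<epsilon>: "\<epsilon> > 0"
    and inv: "\<And>t::real. \<bar>t\<bar> < \<epsilon> \<Longrightarrow> invertible (mat 1 + t *\<^sub>R X) \<and> invertible (mat 1 + t *\<^sub>R Y)"
    by (auto simp: eventually_nhds_metric dist_real_def)
  \<comment> \<open>The matrix component of the curve is (1 + tX) A (1 + tY), of constant rank for small t.\<close>
  define \<gamma> where "\<gamma> t = \<sigma> + t *\<^sub>R w + t\<^sup>2 *\<^sub>R (0, 0, X ** A ** Y)" for t :: real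
  \<comment> \<open>In the expanded product the coefficient of \<open>t\<close> is
    \<open>X ** A + A ** Y = B\<close>.\<close>
  have prod: "snd (snd (\<gamma> t)) = (mat 1 + t *\<^sub>R X) ** A ** (mat 1 + t *\<^sub>R Y)" for t
    unfolding matrix_add_ldistrib matrix_add_rdistrib scalar_matrix_assoc[symmetric]
      matrix_scalar_ac matrix_mul_lid matrix_mul_rid X \<gamma>_def \<sigma>_eq w
    by (simp add: scaleR_right_distrib scaleR_diff_right power2_eq_square)
  have "\<gamma> ` {-\<epsilon><..<\<epsilon>} \<subseteq> S1"
  proof (rule image_subsetI)
    fix t assume "t \<in> {-\<epsilon><..<\<epsilon>}"
    with inv[of t] have "rank (snd (snd (\<gamma> t))) = rank A"
      unfolding prod by (intro rank_mult_invertible) auto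
    then show "\<gamma> t \<in> S1"
      using \<sigma> by (simp add: mem_S1_iff[OF le] \<sigma>_eq)
  qed
  moreover have "(\<gamma> has_vector_derivative w) (at 0)"
    unfolding \<gamma>_def by (auto intro!: derivative_eq_intros simp: has_vector_derivative_def simp flip: zero_prod_def)
  moreover have "smooth_on {-\<epsilon><..<\<epsilon>} \<gamma>"
    unfolding smooth_on_def \<gamma>_def by (blast intro: Ck_on_quadratic_curve)
  moreover have "\<gamma> 0 = \<sigma>" by (simp add: \<gamma>_def flip: zero_prod_def)
  ultimately show "w \<in> tangent_space S1 \<sigma>"
    using \<epsilon> unfolding tangent_space_def by blast
qed

section \<open>Derivatives of the Jacobian and of its minors\<close>

lemma differentiable_vec_lambda:
  fixes g :: "'i::finite \<Rightarrow> 'a::real_normed_vector \<Rightarrow> 'b::euclidean_space"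
  assumes "\<And>i. g i differentiable (at x)"
  shows "(\<lambda>x. \<chi> i. g i x) differentiable (at x)"
proof -
  have "(\<lambda>x. (\<chi> i. g i x) \<bullet> axis i b) differentiable (at x)" for i b
    unfolding inner_axis by (simp add: assms differentiable_inner)
  then have "(\<lambda>x. (\<chi> i. g i x) \<bullet> e) differentiable (at x)" if "e \<in> Basis" for e
    using that unfolding Basis_vec_def by blast
  then show ?thesis
    using differentiable_componentwise_within[of "\<lambda>x. \<chi> i. g i x" x UNIV] by blast
qed

lemma differentiable_vec_nth:
  "f differentiable (at x) \<Longrightarrow> (\<lambda>x. f x $ i) differentiable (at x)"
  unfolding differentiable_def
  using bounded_linear.has_derivative[OF bounded_linear_vec_nth] by blast

lemma smooth_on_UNIV_differentiable:
  assumes "smooth_on UNIV f"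
  shows "f differentiable (at x)" "(\<lambda>x. frechet_derivative f (at x) v) differentiable (at x)"
proof -
  have "Ck_on (Suc (Suc 0)) f UNIV"
    using assms unfolding smooth_on_def by blast
  then show "f differentiable (at x)" "(\<lambda>x. frechet_derivative f (at x) v) differentiable (at x)"
    by simp_all
qed

lemma differentiable_jacobian:
  fixes f :: "real^'m::finite \<Rightarrow> real^'n::finite"
  assumes "smooth_on UNIV f"
  shows "(\<lambda>x. jacobian f (at x)) differentiable (at x)"
  unfolding jacobian_def matrix_def
  by (intro differentiable_vec_lambda differentiable_vec_nth smooth_on_UNIV_differentiable(2)[OF assms])

lemma has_vector_derivative_along_line:
  assumes "(g has_derivative D) (at p)"
  shows "((\<lambda>t. g (p + t *\<^sub>R v)) has_vector_derivative D v) (at 0)"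
proof -
  have "((\<lambda>t. p + t *\<^sub>R v) has_derivative (\<lambda>t. t *\<^sub>R v)) (at 0)"
    by (auto intro!: derivative_eq_intros)
  from has_derivative_compose[OF this, of g D] assms
  have "((\<lambda>t. g (p + t *\<^sub>R v)) has_derivative (\<lambda>t. D (t *\<^sub>R v))) (at 0)"
    by simp
  then show ?thesis
    by (simp add: has_vector_derivative_def linear_scale[OF has_derivative_linear[OF assms]])
qed

text \<open>On the line \<open>p + t *\<^sub>R v\<close> the Jacobian is a curve of matrices with
  velocity \<open>D v\<close> at 0, and the derivatives of its minors are the components of the
  derivative of \<open>minors_map r f\<close> in direction \<open>v\<close>.\<close>

lemma jacobian_minors_map_mult_eq_0_iff:
  fixes f :: "real^'m::finite \<Rightarrow> real^'n::finite" and r :: "'s::finite \<Rightarrow> 'm \<Rightarrow> 'n"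
  assumes r: "minor_enumeration r" and f: "smooth_on UNIV f"
    and D: "((\<lambda>x. jacobian f (at x)) has_derivative D) (at p)"
    and k: "k \<noteq> 0" "jacobian f (at p) *v k = 0"
    and ker: "\<And>x. jacobian f (at p) *v x = 0 \<Longrightarrow> \<exists>c. x = c *\<^sub>R k"
  shows "jacobian (minors_map r f) (at p) *v v = 0 \<longleftrightarrow> D v *v k \<in> range ((*v) (jacobian f (at p)))"
proof -
  have "minors_map r f differentiable (at p)"
    unfolding minors_map_def[abs_def]
    by (intro differentiable_vec_lambda differentiable_det)
      (simp only: vec_lambda_beta, intro differentiable_vec_nth differentiable_jacobian[OF f])
  then have "(minors_map r f has_derivative (*v) (jacobian (minors_map r f) (at p))) (at p)"
    by (simp only: jacobian_works)
  from has_vector_derivative_along_line[OF this, of v]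
  have "((\<lambda>t. minors_map r f (p + t *\<^sub>R v) $ s) has_real_derivative
      (jacobian (minors_map r f) (at p) *v v) $ s) (at 0)" for s
    unfolding has_real_derivative_iff_has_vector_derivative
    by (rule bounded_linear.has_vector_derivative[OF bounded_linear_vec_nth])
  then have "((\<lambda>t. det (\<chi> i j. jacobian f (at (p + t *\<^sub>R v)) $ r s i $ j)) has_real_derivative
      (jacobian (minors_map r f) (at p) *v v) $ s) (at 0)" for s
    by (simp add: minors_map_def)
  from minors_derivative_vanish_iff[OF r has_vector_derivative_along_line[OF D] _ _ _ this] k ker
  show ?thesis
    by (simp add: vec_eq_iff)
qed

section \<open>Transversality to \<open>S1\<close> and the cross-cap criterion\<close>

text \<open>The first two components of a tangent vector of \<open>S1\<close> are free, so only the
  matrix component restricts. The restriction sees a matrix \<open>C\<close> only through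
  \<open>C *v k\<close>, which can be any vector.\<close>

lemma transversal_at_S1_iff:
  fixes f :: "real^'m::finite \<Rightarrow> real^'n::finite" and r :: "'s::finite \<Rightarrow> 'm \<Rightarrow> 'n"
  assumes r: "minor_enumeration r" and le: "CARD('m) \<le> CARD('n)" and f: "smooth_on UNIV f"
    and S1: "j1 f p \<in> S1" and D: "((\<lambda>x. jacobian f (at x)) has_derivative D) (at p)"
    and k: "k \<noteq> 0" "jacobian f (at p) *v k = 0"
    and ker: "\<And>x. jacobian f (at p) *v x = 0 \<Longrightarrow> \<exists>c. x = c *\<^sub>R k"
  shows "transversal_at (j1 f) S1 p \<longleftrightarrow>
    {D v *v k + y | v y. y \<in> range ((*v) (jacobian f (at p)))} = UNIV"
proof -
  let ?A = "jacobian f (at p)"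
  have "(j1 f has_derivative (\<lambda>v. (v, ?A *v v, D v))) (at p)"
    unfolding j1_def[abs_def]
    using smooth_on_UNIV_differentiable(1)[OF f, of p, unfolded jacobian_works]
    by (intro has_derivative_Pair has_derivative_ident D)
  from frechet_derivative_at[OF this, symmetric]
  have F: "frechet_derivative (j1 f) (at p) = (\<lambda>v. (v, ?A *v v, D v))" .
  have T: "tangent_space S1 (j1 f p) = {(a, b, B). B *v k \<in> range ((*v) ?A)}"
    using tangent_space_S1[OF r le S1] k ker by (simp add: j1_def)
  have diff_mem_iff: "a - b \<in> R \<longleftrightarrow> (\<exists>y. y \<in> R \<and> a = b + y)" for a b :: "real^'n" and R
    by (metis add_diff_cancel_left' add.commute diff_add_cancel)
  have "transversal_at (j1 f) S1 p \<longleftrightarrow>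
      (\<forall>w. \<exists>v u. u \<in> tangent_space S1 (j1 f p) \<and> w = (v, ?A *v v, D v) + u)"
    unfolding transversal_at_def F using S1 by (simp only: not_not simp_thms) blast
  also have "\<dots> \<longleftrightarrow> (\<forall>C. \<exists>v. (C - D v) *v k \<in> range ((*v) ?A))"
  proof (intro iffI allI)
    \<comment> \<open>Testing jets \<open>(0, 0, C)\<close> is enough to extract the condition on
      the matrix component.\<close>
    fix C
    assume "\<forall>w. \<exists>v u. u \<in> tangent_space S1 (j1 f p) \<and> w = (v, ?A *v v, D v) + u"
    then obtain v u where u: "u \<in> tangent_space S1 (j1 f p)" "(0, 0, C) = (v, ?A *v v, D v) + u"
      by blast
    then have "snd (snd u) = C - D v"
      by (metis add_diff_cancel_left' snd_add snd_conv)
    with u(1) show "\<exists>v. (C - D v) *v k \<in> range ((*v) ?A)"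
      unfolding T by (auto simp: case_prod_beta)
  next
    fix w :: "('m, 'n) jet1"
    assume C: "\<forall>C. \<exists>v. (C - D v) *v k \<in> range ((*v) ?A)"
    obtain a b C where w: "w = (a, b, C)" by (cases w)
    obtain v where "(C - D v) *v k \<in> range ((*v) ?A)" using C by blast
    then have "(a - v, b - ?A *v v, C - D v) \<in> tangent_space S1 (j1 f p)"
      unfolding T by simp
    moreover have "w = (v, ?A *v v, D v) + (a - v, b - ?A *v v, C - D v)"
      by (simp add: w)
    ultimately show "\<exists>v u. u \<in> tangent_space S1 (j1 f p) \<and> w = (v, ?A *v v, D v) + u"
      by blast
  qed
  also have "\<dots> \<longleftrightarrow> (\<forall>C. \<exists>v y. y \<in> range ((*v) ?A) \<and> C *v k = D v *v k + y)"
    unfolding matrix_vector_mult_diff_rdistrib diff_mem_iff ..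
  also have "\<dots> \<longleftrightarrow> (\<forall>x. \<exists>v y. y \<in> range ((*v) ?A) \<and> x = D v *v k + y)"
    using k(1) by (metis matrix_with_prescribed_value)
  also have "\<dots> \<longleftrightarrow> {D v *v k + y | v y. y \<in> range ((*v) ?A)} = UNIV"
    by blast
  finally show ?thesis .
qed

theorem lemma2p3:
  fixes f :: "real^'m::finite \<Rightarrow> real^'n::finite"
    and r :: "'s::finite \<Rightarrow> 'm \<Rightarrow> 'n"
    and p :: "real^'m"
  assumes "CARD('n) = 2 * CARD('m) - 1"
    and "CARD('s) = (2 * CARD('m) - 1) choose CARD('m)"
    and "minor_enumeration r"
    and "smooth_on UNIV f"
  shows "cross_cap f p \<longleftrightarrow>
    rank (jacobian f (at p)) = CARD('m) - 1 \<and>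
    rank (jacobian (minors_map r f) (at p)) = CARD('m)"
proof -
  let ?A = "jacobian f (at p)"
  have m: "0 < CARD('m)" by simp
  with assms(1) have le: "CARD('m) \<le> CARD('n)" by linarith
  have S1: "j1 f p \<in> S1 \<longleftrightarrow> rank ?A = CARD('m) - 1"
    using mem_S1_iff[OF le, of "j1 f p"] by (simp add: j1_def)
  have "transversal_at (j1 f) S1 p \<longleftrightarrow> rank (jacobian (minors_map r f) (at p)) = CARD('m)"
    if rank: "rank ?A = CARD('m) - 1"
  proof -
    obtain k where k: "k \<noteq> 0" "?A *v k = 0" "\<And>x. ?A *v x = 0 \<Longrightarrow> \<exists>c. x = c *\<^sub>R k"
      using kernel_corank_one[OF rank] by blast
    obtain D where D: "((\<lambda>x. jacobian f (at x)) has_derivative D) (at p)"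
      using differentiable_jacobian[OF assms(4)] unfolding differentiable_def by blast
    \<comment> \<open>\<open>M\<close> is the matrix of the linear map called \<open>L v\<close> in
      the overview.\<close>
    define M where "M = matrix (\<lambda>v. D v *v k)"
    have "linear (\<lambda>v. D v *v k)"
      using linear_add[OF has_derivative_linear[OF D]] linear_scale[OF has_derivative_linear[OF D]]
      by (intro linearI; simp add: matrix_vector_mult_add_rdistrib scaleR_matrix_vector_assoc)
    then have M: "M *v v = D v *v k" for v
      by (simp add: M_def matrix_works)
    \<comment> \<open>Here the target dimension enters:
      \<open>m + (m - 1) = 2 * m - 1\<close>.\<close>
    have "CARD('m) + dim (range ((*v) ?A)) = CARD('n)"
      using rank m assms(1) unfolding rank_dim_range by linarith
    moreover have "subspace (range ((*v) ?A))"
      by (simp add: linear_subspace_image)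
    ultimately have "transversal_at (j1 f) S1 p \<longleftrightarrow>
        (\<forall>v. M *v v \<in> range ((*v) ?A) \<longrightarrow> v = 0)"
      using transversal_at_S1_iff[OF assms(3) le assms(4) _ D k] S1 rank
        range_plus_subspace_eq_UNIV_iff[of "range ((*v) ?A)" M]
      by (simp only: M)
    also have "\<dots> \<longleftrightarrow> (\<forall>v. jacobian (minors_map r f) (at p) *v v = 0 \<longrightarrow> v = 0)"
      using jacobian_minors_map_mult_eq_0_iff[OF assms(3,4) D k] by (simp only: M)
    also have "\<dots> \<longleftrightarrow> \<not> rank (jacobian (minors_map r f) (at p)) < CARD('m)"
      unfolding rank_less_iff_kernel by blast
    also have "\<dots> \<longleftrightarrow> rank (jacobian (minors_map r f) (at p)) = CARD('m)"
      using rank_bound[of "jacobian (minors_map r f) (at p)"] by auto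
    finally show ?thesis .
  qed
  then show ?thesis
    using S1 by (auto simp: cross_cap_def S1_of_def)
qed

end
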